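(* Let $\alpha,\beta\in\mathbb{C}$. Let $\Gamma$ be a rectifiable path in the complex plane with endpoint $z_\ast$ such that analytic continuation along $\Gamma$ of a solution of the system $q'=p^2+zq+\alpha$, $p'=-q^2-zp-\beta$ (rewritten in the coordinates after the first blow-up) leads to a point $P$ on one of the exceptional curves $L_1^{(\rho)}$, $\rho\in\{1,\omega,\bar\omega\}$. Let $P$ have coordinates $(u_{1,1},u_{1,2})=(c^{-1},0)$ in the first chart and $(u_{2,1},u_{2,2})=(0,c)$, $c\in\mathbb{C}$, in the second chart, respectively. Then $c=\bar\rho z_\ast$.
   Context: Here $z$ is the complex independent variable, $'=d/dz$, $\alpha,\beta$ are complex constants, $\omega=\frac{-1+i\sqrt3}{2}$, and bars denote complex conjugation, so $\bar\rho=\rho^{-1}=\rho^2$ for $\rho\in\{1,\omega,\bar\omega\}$. The phase space of $(q,p)$ is compactified to $\mathbb{CP}^2$, with a chart $(u_1,u_2)$ given by $u_1=1/q$, $u_2=p/q$ (so that $[1:q:p]=[u_1:1:u_2]$). For each $\rho\in\{1,\omega,\bar\omega\}$ the point $(u_1,u_2)=(0,-\rho)$ is blown up, introducing two new coordinate charts $$u_{1,1}=\frac{u_1}{u_2+\rho},\quad u_{1,2}=u_2+\rho\qquad\text{(first chart)},$$ $$u_{2,1}=u_1,\quad u_{2,2}=\frac{u_2+\rho}{u_1}\qquad\text{(second chart)}.$$ The exceptional curve $L_1^{(\rho)}$ of this blow-up is given by $u_{1,2}=0$ in the first chart and by $u_{2,1}=0$ in the second chart, with $u_{1,1}=u_{2,2}^{-1}$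 on the overlap (for $c=0$ the point lies only in the second chart). "Analytic continuation along $\Gamma$ leads to $P$" means that the solution is continued analytically along $\Gamma$ up to the endpoint $z_\ast$ and that, written in these coordinates, it tends to $P$ as $z\to z_\ast$ along $\Gamma$. *)

theory Defs
  imports "HOL-Complex_Analysis.Complex_Analysis"
begin

definition rectifiable_path :: "(real \<Rightarrow> complex) \<Rightarrow> bool" where
  "rectifiable_path \<gamma> \<longleftrightarrow> path \<gamma> \<and>
     (\<exists>L. \<forall>n (s :: nat \<Rightarrow> real). mono_on {..n} s \<and> s ` {..n} \<subseteq> {0..1} \<longrightarrow>
        (\<Sum>i<n. dist (\<gamma> (s i)) (\<gamma> (s (Suc i)))) \<le> L)"

(* F t is the function element at \<gamma> t; only its germ there matters.  The continuation is
   along \<gamma> without its endpoint, i.e. over the parameter interval [0,1). *)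
definition analytic_continuation_upto_end ::
    "(complex \<Rightarrow> complex) \<Rightarrow> (real \<Rightarrow> complex) \<Rightarrow> (real \<Rightarrow> complex \<Rightarrow> complex) \<Rightarrow> bool" where
  "analytic_continuation_upto_end f \<gamma> F \<longleftrightarrow>
     (\<forall>\<^sub>F z in nhds (pathstart \<gamma>). F 0 z = f z) \<and>
     (\<forall>t\<in>{0..<1}. \<exists>r>0. F t holomorphic_on ball (\<gamma> t) r \<and>
        (\<forall>\<^sub>F s in at t within {0..<1}.
           \<gamma> s \<in> ball (\<gamma> t) r \<and> (\<forall>\<^sub>F z in nhds (\<gamma> s). F s z = F t z)))"

definition solves_system ::
    "complex \<Rightarrow> complex \<Rightarrow> complex set \<Rightarrow> (complex \<Rightarrow> complex) \<Rightarrow> (complex \<Rightarrow> complex) \<Rightarrow> bool" where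
  "solves_system \<alpha> \<beta> S q p \<longleftrightarrow>
     (\<forall>z\<in>S. (q has_field_derivative (p z)\<^sup>2 + z * q z + \<alpha>) (at z) \<and>
             (p has_field_derivative - (q z)\<^sup>2 - z * p z - \<beta>) (at z))"

definition omega :: complex where
  "omega = (- 1 + \<i> * complex_of_real (sqrt 3)) / 2"

definition u1 :: "complex \<Rightarrow> complex \<Rightarrow> complex" where
  "u1 q p = 1 / q"

definition u2 :: "complex \<Rightarrow> complex \<Rightarrow> complex" where
  "u2 q p = p / q"

(* Meaningful only if q \<noteq> 0 and u2 q p \<noteq> - \<rho>. *)
definition blowup_chart1 :: "complex \<Rightarrow> complex \<Rightarrow> complex \<Rightarrow> complex \<times> complex" where
  "blowup_chart1 \<rho> q p = (u1 q p / (u2 q p + \<rho>), u2 q p + \<rho>)"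

(* Meaningful only if q \<noteq> 0. *)
definition blowup_chart2 :: "complex \<Rightarrow> complex \<Rightarrow> complex \<Rightarrow> complex \<times> complex" where
  "blowup_chart2 \<rho> q p = (u1 q p, (u2 q p + \<rho>) / u1 q p)"

(* As t tends to 1, (q t, p t) tends to the point of the exceptional curve over (0, - \<rho>) that
   has coordinates (0, c) in the second chart.  The condition q t \<noteq> 0 says that (q t, p t) lies in
   the domain of this chart; without it, division by zero would yield spurious limits.
   For c \<noteq> 0 the first chart gives the same notion, see tends_to_exceptional_point_chart1. *)
definition tends_to_exceptional_point ::
    "complex \<Rightarrow> complex \<Rightarrow> (real \<Rightarrow> complex) \<Rightarrow> (real \<Rightarrow> complex) \<Rightarrow> bool" where
  "tends_to_exceptional_point \<rho> c q p \<longleftrightarrow>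
     (\<forall>\<^sub>F t in at_left 1. q t \<noteq> 0) \<and>
     ((\<lambda>t. blowup_chart2 \<rho> (q t) (p t)) \<longlongrightarrow> (0, c)) (at_left 1)"

lemma tends_to_exceptional_point_chart1:
  assumes "c \<noteq> 0"
  shows "tends_to_exceptional_point \<rho> c q p \<longleftrightarrow>
     (\<forall>\<^sub>F t in at_left 1. q t \<noteq> 0 \<and> u2 (q t) (p t) \<noteq> - \<rho>) \<and>
     ((\<lambda>t. blowup_chart1 \<rho> (q t) (p t)) \<longlongrightarrow> (inverse c, 0)) (at_left 1)"
    (is "?L \<longleftrightarrow> ?R")
proof
  assume L: ?L
  let ?u = "\<lambda>t. u1 (q t) (p t)" and ?w = "\<lambda>t. u2 (q t) (p t) + \<rho>"
  have q: "\<forall>\<^sub>F t in at_left 1. q t \<noteq> 0"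
    and u: "(?u \<longlongrightarrow> 0) (at_left 1)"
    and v: "((\<lambda>t. ?w t / ?u t) \<longlongrightarrow> c) (at_left 1)"
    using L tendsto_fst[of _ "(0, c)"] tendsto_snd[of _ "(0, c)"]
    unfolding tends_to_exceptional_point_def blowup_chart2_def by fastforce+
  have ne: "\<forall>\<^sub>F t in at_left 1. ?w t / ?u t \<noteq> 0"
    using v assms by (rule tendsto_imp_eventually_ne)
  have "((\<lambda>t. ?u t * (?w t / ?u t)) \<longlongrightarrow> 0 * c) (at_left 1)"
    by (intro tendsto_mult u v)
  moreover have "\<forall>\<^sub>F t in at_left 1. ?u t * (?w t / ?u t) = ?w t"
    using q by eventually_elim (simp add: u1_def)
  ultimately have w: "(?w \<longlongrightarrow> 0) (at_left 1)"
    by (simp add: tendsto_cong)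
  have "((\<lambda>t. inverse (?w t / ?u t)) \<longlongrightarrow> inverse c) (at_left 1)"
    by (intro tendsto_inverse v assms)
  then have "((\<lambda>t. ?u t / ?w t) \<longlongrightarrow> inverse c) (at_left 1)"
    by (simp add: inverse_divide)
  moreover have "\<forall>\<^sub>F t in at_left 1. q t \<noteq> 0 \<and> u2 (q t) (p t) \<noteq> - \<rho>"
    using q ne by eventually_elim auto
  ultimately show ?R
    unfolding blowup_chart1_def using w by (auto intro: tendsto_Pair)
next
  assume R: ?R
  let ?u = "\<lambda>t. u1 (q t) (p t)" and ?w = "\<lambda>t. u2 (q t) (p t) + \<rho>"
  have q: "\<forall>\<^sub>F t in at_left 1. q t \<noteq> 0 \<and> u2 (q t) (p t) \<noteq> - \<rho>"
    and w: "(?w \<longlongrightarrow> 0) (at_left 1)"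
    and v: "((\<lambda>t. ?u t / ?w t) \<longlongrightarrow> inverse c) (at_left 1)"
    using R tendsto_fst[of _ "(inverse c, 0)"] tendsto_snd[of _ "(inverse c, 0)"]
    unfolding blowup_chart1_def by fastforce+
  have "((\<lambda>t. ?u t / ?w t * ?w t) \<longlongrightarrow> inverse c * 0) (at_left 1)"
    by (intro tendsto_mult w v)
  moreover have "\<forall>\<^sub>F t in at_left 1. ?u t / ?w t * ?w t = ?u t"
    using q by eventually_elim (simp add: add_eq_0_iff2)
  ultimately have u: "(?u \<longlongrightarrow> 0) (at_left 1)"
    by (simp add: tendsto_cong)
  have "((\<lambda>t. inverse (?u t / ?w t)) \<longlongrightarrow> inverse (inverse c)) (at_left 1)"
    using assms by (intro tendsto_inverse v) auto
  then have "((\<lambda>t. ?w t / ?u t) \<longlongrightarrow> c) (at_left 1)"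
    by (simp add: inverse_divide)
  moreover have "\<forall>\<^sub>F t in at_left 1. q t \<noteq> 0"
    using q by eventually_elim auto
  ultimately show ?L
    unfolding tends_to_exceptional_point_def blowup_chart2_def
    using u by (auto intro: tendsto_Pair)
qed

end

theory Submission
  imports Defs
begin

text \<open>
  In the second chart put \<open>u = 1/q\<close>, \<open>v = p + \<rho> q\<close> and \<open>w = v - \<rho>\<^sup>-\<^sup>1 z\<close>. Since \<open>\<rho>\<^sup>3 = 1\<close>, the system
  becomes \<open>u' = -\<rho>\<^sup>2 + O(u)\<close> and \<open>w' = -2 \<rho>\<^sup>2 w / u + O(1)\<close>. If \<open>w\<close> had a non-zero limit, the poles
  would cancel in the logarithmic derivative of \<open>w / u\<^sup>2\<close>, which would therefore be bounded near
  the end of \<open>\<Gamma>\<close>. As \<open>\<Gamma>\<close> has finite length, \<open>w / u\<^sup>2\<close> itself would be bounded, so \<open>w \<rightarrow> 0\<close>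
  because \<open>u \<rightarrow> 0\<close>: a contradiction. Hence \<open>w \<rightarrow> 0\<close>, which is the claim.
\<close>

section \<open>Arc length of a rectifiable path\<close>

text \<open>\<open>V t\<close> is the supremum of the lengths of polygons inscribed in the path over
  \<open>{0..t}\<close>. A polygon ending by time \<open>a\<close> can be prolonged through \<gamma>
  \<open>a\<close> to \<gamma> \<open>b\<close>, which adds at least the length of the chord between
  these points.\<close>

lemma rectifiable_path_length_function:
  assumes "rectifiable_path \<gamma>"
  obtains V :: "real \<Rightarrow> real"
  where "\<And>a b. 0 \<le> a \<Longrightarrow> a \<le> b \<Longrightarrow> b \<le> 1 \<Longrightarrow> dist (\<gamma> a) (\<gamma> b) \<le> V b - V a"
proof -
  define A where "A t = {\<Sum>i<n. dist (\<gamma> (s i)) (\<gamma> (s (Suc i))) | n s.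
      mono_on {..n::nat} s \<and> s ` {..n} \<subseteq> {0..t}}" for t :: real
  obtain L where L: "\<And>n (s :: nat \<Rightarrow> real). mono_on {..n} s \<Longrightarrow> s ` {..n} \<subseteq> {0..1} \<Longrightarrow>
        (\<Sum>i<n. dist (\<gamma> (s i)) (\<gamma> (s (Suc i)))) \<le> L"
    using assms unfolding rectifiable_path_def by blast
  have bdd: "bdd_above (A t)" if "t \<le> 1" for t
  proof (rule bdd_aboveI)
    fix x assume "x \<in> A t"
    then obtain n s where x: "x = (\<Sum>i<n. dist (\<gamma> (s i)) (\<gamma> (s (Suc i))))"
      and s: "mono_on {..n::nat} s" "s ` {..n} \<subseteq> {0..t}"
      unfolding A_def by blast
    have "s ` {..n} \<subseteq> {0..1}" using s(2) that by fastforce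
    with s(1) L x show "x \<le> L" by blast
  qed
  show thesis
  proof (rule that[of "\<lambda>t. Sup (A t)"])
    fix a b :: real assume ab: "0 \<le> a" "a \<le> b" "b \<le> 1"
    have "Sup (A a) \<le> Sup (A b) - dist (\<gamma> a) (\<gamma> b)"
    proof (rule cSup_least)
      \<comment> \<open>The polygon with the single node \<open>a\<close> has no edges, so its sum
        is empty.\<close>
      have "0 \<in> A a"
        unfolding A_def using ab by (auto intro!: exI[of _ 0] exI[of _ "\<lambda>_. a"] simp: mono_on_def)
      then show "A a \<noteq> {}" by blast
    next
      fix x assume "x \<in> A a"
      then obtain n s where x: "x = (\<Sum>i<n. dist (\<gamma> (s i)) (\<gamma> (s (Suc i))))"
        and s: "mono_on {..n::nat} s" "s ` {..n} \<subseteq> {0..a}"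
        unfolding A_def by blast
      \<comment> \<open>The nodes \<open>a\<close> and \<open>b\<close> are appended at the indices
        \<open>Suc n\<close> and \<open>Suc (Suc n)\<close>. The extra edge from \<gamma>
        (\<open>s n\<close>) to \<gamma> \<open>a\<close> only increases the length and is dropped
        at the end.\<close>
      define s' where "s' i = (if i \<le> n then s i else if i = Suc n then a else b)" for i
      have sa: "0 \<le> s i" "s i \<le> a" if "i \<le> n" for i using s(2) that by auto
      have mono: "mono_on {..Suc (Suc n)} s'"
      proof (rule mono_onI)
        fix i j :: nat assume "i \<le> j"
        then consider "j \<le> n" "i \<le> n" | "i \<le> n" "j > n" | "i > n" "j > n" by linarith
        then show "s' i \<le> s' j"
        proof cases
          case 1
          with s(1) \<open>i \<le> j\<close> show ?thesis by (auto simp: s'_def mono_on_def)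
        next
          case 2
          with sa[of i] ab show ?thesis by (auto simp: s'_def)
        next
          case 3
          with ab \<open>i \<le> j\<close> show ?thesis by (auto simp: s'_def)
        qed
      qed
      have range: "s' ` {..Suc (Suc n)} \<subseteq> {0..b}"
      proof (rule image_subsetI)
        fix i assume "i \<in> {..Suc (Suc n)}"
        show "s' i \<in> {0..b}" using ab sa[of i] by (auto simp: s'_def)
      qed
      have "(\<Sum>i<n. dist (\<gamma> (s' i)) (\<gamma> (s' (Suc i)))) = x"
        unfolding x by (rule sum.cong) (auto simp: s'_def)
      then have "(\<Sum>i<Suc (Suc n). dist (\<gamma> (s' i)) (\<gamma> (s' (Suc i)))) =
          x + dist (\<gamma> (s n)) (\<gamma> a) + dist (\<gamma> a) (\<gamma> b)"
        by (simp add: s'_def)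
      moreover have "(\<Sum>i<Suc (Suc n). dist (\<gamma> (s' i)) (\<gamma> (s' (Suc i)))) \<in> A b"
        unfolding A_def using mono range by blast
      then have "(\<Sum>i<Suc (Suc n). dist (\<gamma> (s' i)) (\<gamma> (s' (Suc i)))) \<le> Sup (A b)"
        using bdd[OF ab(3)] by (rule cSup_upper)
      ultimately show "x \<le> Sup (A b) - dist (\<gamma> a) (\<gamma> b)"
        using zero_le_dist[of "\<gamma> (s n)" "\<gamma> a"] by linarith
    qed
    then show "dist (\<gamma> a) (\<gamma> b) \<le> Sup (A b) - Sup (A a)" by simp
  qed
qed

section \<open>Growth estimates from a bound on the logarithmic derivative\<close>

text \<open>Near \<open>x\<close>, \<open>ln (norm (f z))\<close> is, up to a constant, the real
  part of a holomorphic logarithm of \<open>f\<close>, whose derivative at \<open>x\<close> is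
  \<open>D / f x\<close>. As its norm is strictly less than \<open>K\<close>, the difference absorbs
  the error of the linear approximation.\<close>

lemma eventually_ln_norm_le:
  fixes f :: "complex \<Rightarrow> complex"
  assumes f: "(f has_field_derivative D) (at x)" and nz: "f x \<noteq> 0"
    and D: "norm D < K * norm (f x)"
  shows "\<forall>\<^sub>F z in nhds x. f z \<noteq> 0 \<and> \<bar>ln (norm (f z)) - ln (norm (f x))\<bar> \<le> K * dist x z"
proof -
  \<comment> \<open>Dividing by \<open>f x\<close> moves the value at \<open>x\<close> to 1, away
    from the branch cut of \<open>Ln\<close>, and makes \<open>l x = 0\<close>.\<close>
  define l where "l z = Ln (f z / f x)" for z
  have "((\<lambda>z. f z / f x) has_field_derivative D / f x) (at x)"
    by (rule DERIV_cdivide[OF f])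
  then have "(l has_field_derivative inverse (f x / f x) * (D / f x)) (at x)"
    unfolding l_def using nz by (intro DERIV_chain2[OF has_field_derivative_Ln]) auto
  then have "(l has_derivative (*) (D / f x)) (at x)"
    unfolding has_field_derivative_def using nz by simp
  moreover have "K - norm (D / f x) > 0"
    using D nz by (simp add: norm_divide divide_simps)
  ultimately obtain d where "d > 0" and d: "\<And>y. norm (y - x) < d \<Longrightarrow>
      norm (l y - l x - D / f x * (y - x)) \<le> (K - norm (D / f x)) * norm (y - x)"
    unfolding has_derivative_at_alt by blast
  have "\<forall>\<^sub>F z in nhds x. norm (z - x) < d"
    using \<open>d > 0\<close> by (auto simp: eventually_nhds_metric dist_norm)
  moreover have "\<forall>\<^sub>F z in nhds x. f z \<noteq> 0"
  proof -
    have "(f \<longlongrightarrow> f x) (nhds x)"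
      using DERIV_isCont[OF f] by (simp add: continuous_at_imp_continuous_at_within isCont_def tendsto_at_iff_tendsto_nhds)
    then show ?thesis using nz by (rule tendsto_imp_eventually_ne)
  qed
  ultimately show ?thesis
  proof eventually_elim
    case (elim z)
    have "norm (l z - l x) \<le> norm (l z - l x - D / f x * (z - x)) + norm (D / f x * (z - x))"
      using norm_triangle_ineq[of "l z - l x - D / f x * (z - x)" "D / f x * (z - x)"] by simp
    also have "\<dots> \<le> (K - norm (D / f x)) * norm (z - x) + norm (D / f x) * norm (z - x)"
      using d[OF elim(1)] unfolding norm_mult by simp
    also have "\<dots> = K * dist x z"
      by (simp add: algebra_simps dist_norm norm_minus_commute)
    finally have "\<bar>Re (l z - l x)\<bar> \<le> K * dist x z"
      using abs_Re_le_cmod order_trans by blast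
    moreover have "Re (l z - l x) = ln (norm (f z)) - ln (norm (f x))"
      using elim nz by (simp add: l_def norm_divide ln_div)
    ultimately show ?case using elim by simp
  qed
qed

text \<open>The path need not be differentiable, so an integral of the logarithmic derivative is replaced
  by a compactness argument on local estimates.\<close>

lemma norm_growth_along_path:
  fixes h :: "real \<Rightarrow> complex" and \<gamma> :: "real \<Rightarrow> complex"
  assumes ab: "a \<le> b" and cont: "continuous_on {a..b} \<gamma>"
    and V: "\<And>s t. a \<le> s \<Longrightarrow> s \<le> t \<Longrightarrow> t \<le> b \<Longrightarrow> dist (\<gamma> s) (\<gamma> t) \<le> V t - V s"
    and K: "K \<ge> 0"
    and loc: "\<And>t. t \<in> {a..b} \<Longrightarrow> \<exists>f D. (f has_field_derivative D) (at (\<gamma> t)) \<and>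
        norm D < K * norm (h t) \<and> f (\<gamma> t) = h t \<and> (\<forall>\<^sub>F s in at t within {a..b}. h s = f (\<gamma> s))"
  shows "norm (h b) \<le> norm (h a) * exp (K * (V b - V a))"
proof -
  \<comment> \<open>At a zero of \<open>h\<close> the strict bound would read
    \<open>norm D < 0\<close>.\<close>
  have nz: "h t \<noteq> 0" if "t \<in> {a..b}" for t
    using loc[OF that] by fastforce
  \<comment> \<open>\<open>Bolzano\<close> also asks about intervals that stick out of
    \<open>{a..b}\<close>; the premise inside \<open>R\<close> makes these trivial.\<close>
  define R where "R s t \<longleftrightarrow> (a \<le> s \<and> s \<le> t \<and> t \<le> b \<longrightarrow>
      ln (norm (h t)) - ln (norm (h s)) \<le> K * (V t - V s))" for s t
  have "R a b"
  proof (rule Bolzano[OF ab])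
    fix x y z assume "R x y" "R y z" "x \<le> y" "y \<le> z"
    then show "R x z" unfolding R_def by (auto simp: algebra_simps)
  next
    fix t assume t: "a \<le> t" "t \<le> b"
    then obtain f D where f: "(f has_field_derivative D) (at (\<gamma> t))" "norm D < K * norm (h t)"
      "f (\<gamma> t) = h t" and ev: "\<forall>\<^sub>F s in at t within {a..b}. h s = f (\<gamma> s)"
      using loc[of t] by auto
    have "\<forall>\<^sub>F z in nhds (\<gamma> t). f z \<noteq> 0 \<and> \<bar>ln (norm (f z)) - ln (norm (f (\<gamma> t)))\<bar> \<le> K * dist (\<gamma> t) z"
      using f nz[of t] t by (intro eventually_ln_norm_le) auto
    moreover have "(\<gamma> \<longlongrightarrow> \<gamma> t) (at t within {a..b})"
      using cont t by (simp add: continuous_on_def)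
    ultimately have "\<forall>\<^sub>F s in at t within {a..b}.
        f (\<gamma> s) \<noteq> 0 \<and> \<bar>ln (norm (f (\<gamma> s))) - ln (norm (f (\<gamma> t)))\<bar> \<le> K * dist (\<gamma> t) (\<gamma> s)"
      by (rule eventually_compose_filterlim)
    with ev have "\<forall>\<^sub>F s in at t within {a..b}. \<bar>ln (norm (h s)) - ln (norm (h t))\<bar> \<le> K * dist (\<gamma> t) (\<gamma> s)"
      by eventually_elim (simp add: f(3))
    then obtain d where "d > 0" and d: "\<And>s. s \<in> {a..b} \<Longrightarrow> s \<noteq> t \<Longrightarrow> dist s t < d \<Longrightarrow>
        \<bar>ln (norm (h s)) - ln (norm (h t))\<bar> \<le> K * dist (\<gamma> t) (\<gamma> s)"
      unfolding eventually_at by blast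
    have d': "\<bar>ln (norm (h s)) - ln (norm (h t))\<bar> \<le> K * dist (\<gamma> t) (\<gamma> s)"
      if "s \<in> {a..b}" "dist s t < d" for s
      using d[of s] that by (cases "s = t") auto
    \<comment> \<open>The local estimate compares only with the value at \<open>t\<close>. It is
      applied on both sides of \<open>t\<close>, and the increments of \<open>V\<close> add
      up.\<close>
    have "R x y" if xy: "x \<le> t" "t \<le> y" "y - x < d" for x y
      unfolding R_def
    proof (intro impI)
      assume "a \<le> x \<and> x \<le> y \<and> y \<le> b"
      then have ax: "a \<le> x" and yb: "y \<le> b" by auto
      have "\<bar>ln (norm (h x)) - ln (norm (h t))\<bar> \<le> K * dist (\<gamma> x) (\<gamma> t)"
        using d'[of x] ax t xy by (simp add: dist_real_def dist_commute)
      also have "\<dots> \<le> K * (V t - V x)"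
        using K V[of x t] ax t xy by (intro mult_left_mono) auto
      finally have 1: "\<bar>ln (norm (h x)) - ln (norm (h t))\<bar> \<le> K * (V t - V x)" .
      have "\<bar>ln (norm (h y)) - ln (norm (h t))\<bar> \<le> K * dist (\<gamma> t) (\<gamma> y)"
        using d'[of y] yb t xy by (simp add: dist_real_def)
      also have "\<dots> \<le> K * (V y - V t)"
        using K V[of t y] yb t xy by (intro mult_left_mono) auto
      finally have 2: "\<bar>ln (norm (h y)) - ln (norm (h t))\<bar> \<le> K * (V y - V t)" .
      show "ln (norm (h y)) - ln (norm (h x)) \<le> K * (V y - V x)"
        using 1 2 by (simp add: algebra_simps abs_le_iff)
    qed
    with \<open>d > 0\<close> show "\<exists>d>0. \<forall>x y. x \<le> t \<and> t \<le> y \<and> y - x < d \<longrightarrow> R x y" by blast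
  qed
  then have "ln (norm (h b)) \<le> ln (norm (h a)) + K * (V b - V a)"
    using ab by (simp add: R_def)
  then have "exp (ln (norm (h b))) \<le> exp (ln (norm (h a)) + K * (V b - V a))"
    by simp
  then show ?thesis
    using nz[of a] nz[of b] ab by (simp add: exp_add)
qed

section \<open>Persistence of the differential system under analytic continuation\<close>

lemma solves_system_cong:
  assumes "open N" "solves_system \<alpha> \<beta> N q p"
    and "\<And>z. z \<in> N \<Longrightarrow> q' z = q z" "\<And>z. z \<in> N \<Longrightarrow> p' z = p z"
  shows "solves_system \<alpha> \<beta> N q' p'"
  unfolding solves_system_def
proof (intro ballI conjI)
  fix z assume z: "z \<in> N"
  have "(q has_field_derivative (p' z)\<^sup>2 + z * q' z + \<alpha>) (at z)"
    and "(p has_field_derivative - (q' z)\<^sup>2 - z * p' z - \<beta>) (at z)"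
    using assms z by (auto simp: solves_system_def)
  then show "(q' has_field_derivative (p' z)\<^sup>2 + z * q' z + \<alpha>) (at z)"
    and "(p' has_field_derivative - (q' z)\<^sup>2 - z * p' z - \<beta>) (at z)"
    using assms(1,3,4) z by (auto intro: has_field_derivative_transform_within_open)
qed

text \<open>Both sides of each equation, with \<open>deriv\<close> on the left, are holomorphic on
  the connected set \<open>B\<close>, so the identity theorem carries their equality over from
  \<open>N\<close>.\<close>

lemma solves_system_identity:
  assumes "open N" "N \<noteq> {}" "N \<subseteq> B" "open B" "connected B"
    and hol: "q holomorphic_on B" "p holomorphic_on B"
    and "solves_system \<alpha> \<beta> N q p"
  shows "solves_system \<alpha> \<beta> B q p"
  unfolding solves_system_def
proof (intro ballI conjI)
  fix z assume z: "z \<in> B"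
  have N: "\<forall>z\<in>N. deriv q z = (p z)\<^sup>2 + z * q z + \<alpha>" "\<forall>z\<in>N. deriv p z = - (q z)\<^sup>2 - z * p z - \<beta>"
    using assms(8) by (auto simp: solves_system_def intro: DERIV_imp_deriv)
  have "deriv q z = (p z)\<^sup>2 + z * q z + \<alpha>"
    by (rule analytic_continuation_open[of N B "deriv q"])
      (use assms N z in \<open>auto intro!: holomorphic_intros\<close>)
  moreover have "deriv p z = - (q z)\<^sup>2 - z * p z - \<beta>"
    by (rule analytic_continuation_open[of N B "deriv p"])
      (use assms N z in \<open>auto intro!: holomorphic_intros\<close>)
  ultimately show "(q has_field_derivative (p z)\<^sup>2 + z * q z + \<alpha>) (at z)"
    "(p has_field_derivative - (q z)\<^sup>2 - z * p z - \<beta>) (at z)"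
    using holomorphic_derivI[OF hol(1) \<open>open B\<close> z] holomorphic_derivI[OF hol(2) \<open>open B\<close> z]
    by simp_all
qed

text \<open>Whether the function elements at parameter \<open>t\<close> solve the system near
  \<gamma> \<open>t\<close> is a locally constant property of \<open>t\<close>, by the identity
  theorem. It holds at 0, hence on the whole of \<open>{0..<1}\<close> by connectedness.\<close>

lemma solves_system_continuation:
  assumes path: "path \<gamma>" and S: "open S" "pathstart \<gamma> \<in> S" "solves_system \<alpha> \<beta> S q p"
    and Q: "analytic_continuation_upto_end q \<gamma> Q"
    and P: "analytic_continuation_upto_end p \<gamma> P"
    and t: "t \<in> {0..<1}"
  shows "\<exists>N. open N \<and> \<gamma> t \<in> N \<and> solves_system \<alpha> \<beta> N (Q t) (P t)"
proof -
  define E where "E t \<longleftrightarrow> (\<exists>N. open N \<and> \<gamma> t \<in> N \<and> solves_system \<alpha> \<beta> N (Q t) (P t))" for t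
  have "E 0"
  proof -
    have "\<forall>\<^sub>F z in nhds (pathstart \<gamma>). Q 0 z = q z \<and> P 0 z = p z"
      using Q P unfolding analytic_continuation_upto_end_def by (simp add: eventually_conj)
    then obtain N where N: "open N" "pathstart \<gamma> \<in> N" "\<And>z. z \<in> N \<Longrightarrow> Q 0 z = q z \<and> P 0 z = p z"
      unfolding eventually_nhds by blast
    have "solves_system \<alpha> \<beta> (S \<inter> N) q p"
      using S(3) by (simp add: solves_system_def)
    then have "solves_system \<alpha> \<beta> (S \<inter> N) (Q 0) (P 0)"
      by (rule solves_system_cong[rotated]) (use S(1) N in auto)
    then show "E 0"
      unfolding E_def using S N by (intro exI[of _ "S \<inter> N"]) (auto simp: pathstart_def)
  qed
  have loc: "\<forall>\<^sub>F s in at t within {0..<1}. E s = E t" if t: "t \<in> {0..<1}" for t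
  proof -
    obtain r1 where r1: "r1 > 0" "Q t holomorphic_on ball (\<gamma> t) r1"
      and ev1: "\<forall>\<^sub>F s in at t within {0..<1}. \<gamma> s \<in> ball (\<gamma> t) r1 \<and> (\<forall>\<^sub>F z in nhds (\<gamma> s). Q s z = Q t z)"
      using Q t unfolding analytic_continuation_upto_end_def by blast
    obtain r2 where r2: "r2 > 0" "P t holomorphic_on ball (\<gamma> t) r2"
      and ev2: "\<forall>\<^sub>F s in at t within {0..<1}. \<gamma> s \<in> ball (\<gamma> t) r2 \<and> (\<forall>\<^sub>F z in nhds (\<gamma> s). P s z = P t z)"
      using P t unfolding analytic_continuation_upto_end_def by blast
    define B where "B = ball (\<gamma> t) (min r1 r2)"
    have B: "open B" "connected B" "\<gamma> t \<in> B" "Q t holomorphic_on B" "P t holomorphic_on B"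
      using r1 r2 by (auto simp: B_def intro: holomorphic_on_subset)
    \<comment> \<open>A solution on any open set meeting \<open>B\<close> spreads to all of
      \<open>B\<close>, which contains \<gamma> \<open>t\<close> and, for nearby \<open>s\<close>,
      also \<gamma> \<open>s\<close>. This lets the property pass between \<open>s\<close> and
      \<open>t\<close> in both directions.\<close>
    have Et: "solves_system \<alpha> \<beta> B (Q t) (P t)"
      if "open N" "s \<in> N" "s \<in> B" "solves_system \<alpha> \<beta> N (Q t) (P t)" for N s
    proof (rule solves_system_identity[of "N \<inter> B"])
      show "solves_system \<alpha> \<beta> (N \<inter> B) (Q t) (P t)"
        using that by (simp add: solves_system_def)
    qed (use that B in auto)
    from ev1 ev2 show ?thesis
    proof eventually_elim
      case (elim s)
      then have sB: "\<gamma> s \<in> B" by (simp add: B_def)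
      have "\<forall>\<^sub>F z in nhds (\<gamma> s). Q s z = Q t z \<and> P s z = P t z"
        using elim by (simp add: eventually_conj)
      then obtain M where M: "open M" "\<gamma> s \<in> M" "\<And>z. z \<in> M \<Longrightarrow> Q s z = Q t z \<and> P s z = P t z"
        unfolding eventually_nhds by blast
      show "E s = E t"
      proof
        assume "E s"
        then obtain N where N: "open N" "\<gamma> s \<in> N" "solves_system \<alpha> \<beta> N (Q s) (P s)"
          unfolding E_def by blast
        then have "solves_system \<alpha> \<beta> (N \<inter> M) (Q s) (P s)"
          by (simp add: solves_system_def)
        then have "solves_system \<alpha> \<beta> (N \<inter> M) (Q t) (P t)"
          by (rule solves_system_cong[rotated]) (use N M in auto)
        then have "solves_system \<alpha> \<beta> B (Q t) (P t)"
          using Et[of "N \<inter> M"] N M sB by blast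
        then show "E t" unfolding E_def using B by blast
      next
        assume "E t"
        then have "solves_system \<alpha> \<beta> B (Q t) (P t)"
          using Et B unfolding E_def by blast
        then have "solves_system \<alpha> \<beta> (B \<inter> M) (Q t) (P t)"
          by (simp add: solves_system_def)
        then have "solves_system \<alpha> \<beta> (B \<inter> M) (Q s) (P s)"
          by (rule solves_system_cong[rotated]) (use B M in auto)
        then show "E s"
          unfolding E_def using B M sB by (intro exI[of _ "B \<inter> M"]) auto
      qed
    qed
  qed
  define R where "R x y \<longleftrightarrow> (0 \<le> x \<and> x \<le> y \<and> y \<le> t \<longrightarrow> E x = E y)" for x y
  have "0 \<le> t" using t by simp
  then have "R 0 t"
  proof (rule Bolzano)
    fix x y z assume "R x y" "R y z" "x \<le> y" "y \<le> z"
    then show "R x z" by (auto simp: R_def)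
  next
    fix x assume x: "0 \<le> x" "x \<le> t"
    then have "\<forall>\<^sub>F s in at x within {0..<1}. E s = E x" using t by (intro loc) auto
    then obtain d where "d > 0" and d: "\<And>s. s \<in> {0..<1} \<Longrightarrow> s \<noteq> x \<Longrightarrow> dist s x < d \<Longrightarrow> E s = E x"
      unfolding eventually_at by blast
    have d': "E s = E x" if "0 \<le> s" "s \<le> t" "\<bar>s - x\<bar> < d" for s
      using d[of s] that t by (cases "s = x") (auto simp: dist_real_def)
    have "R y z" if "y \<le> x" "x \<le> z" "z - y < d" for y z
      using d'[of y] d'[of z] that x by (auto simp: R_def)
    with \<open>d > 0\<close> show "\<exists>d>0. \<forall>y z. y \<le> x \<and> x \<le> z \<and> z - y < d \<longrightarrow> R y z"
      by blast
  qed
  with \<open>E 0\<close> t show ?thesis by (simp add: E_def R_def)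
qed

section \<open>Algebra of the system at the three base points\<close>

lemma cube_root_of_unity:
  assumes "\<rho> \<in> {1, omega, cnj omega}"
  shows "\<rho> ^ 3 = 1" "cnj \<rho> = \<rho>\<^sup>2"
proof -
  have "omega\<^sup>2 = cnj omega" "(cnj omega)\<^sup>2 = omega" "omega * cnj omega = 1"
    by (simp_all add: omega_def complex_eq_iff power2_eq_square field_simps)
  with assms show "\<rho> ^ 3 = 1" "cnj \<rho> = \<rho>\<^sup>2"
    by (auto simp: power3_eq_cube power2_eq_square mult.commute)
qed

text \<open>The terms of order \<open>q\<close> cancel in the logarithmic derivative of \<open>w q\<^sup>2\<close>.\<close>

lemma log_derivative_cancellation:
  fixes q p :: "complex \<Rightarrow> complex"
  assumes \<rho>: "\<rho> ^ 3 = 1"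
    and q: "(q has_field_derivative (p z)\<^sup>2 + z * q z + \<alpha>) (at z)"
    and p: "(p has_field_derivative - (q z)\<^sup>2 - z * p z - \<beta>) (at z)"
    and nz: "q z \<noteq> 0" "w \<noteq> 0"
    and v: "v = p z + \<rho> * q z" and w: "w = v - \<rho>\<^sup>2 * z"
  shows "((\<lambda>z. (p z + \<rho> * q z - \<rho>\<^sup>2 * z) * (q z)\<^sup>2) has_field_derivative
    (w * (q z)\<^sup>2) * ((\<rho> * v\<^sup>2 - z * v + \<rho> * \<alpha> - \<beta> - \<rho>\<^sup>2) / w
       + 2 * (v\<^sup>2 * (1 / q z) - 2 * \<rho> * v + z + \<alpha> * (1 / q z)))) (at z)"
proof -
  have "((\<lambda>z. (p z + \<rho> * q z - \<rho>\<^sup>2 * z) * (q z)\<^sup>2) has_field_derivative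
    ((- (q z)\<^sup>2 - z * p z - \<beta>) + \<rho> * ((p z)\<^sup>2 + z * q z + \<alpha>) - \<rho>\<^sup>2) * (q z)\<^sup>2
    + w * (2 * q z * ((p z)\<^sup>2 + z * q z + \<alpha>))) (at z)" (is "(_ has_field_derivative ?D) _")
    unfolding w v by (auto intro!: derivative_eq_intros q p simp: algebra_simps)
  moreover have "(w * (q z)\<^sup>2) * ((\<rho> * v\<^sup>2 - z * v + \<rho> * \<alpha> - \<beta> - \<rho>\<^sup>2) / w
       + 2 * (v\<^sup>2 * (1 / q z) - 2 * \<rho> * v + z + \<alpha> * (1 / q z)))
    = (q z)\<^sup>2 * (\<rho> * v\<^sup>2 - z * v + \<rho> * \<alpha> - \<beta> - \<rho>\<^sup>2)
       + 2 * w * q z * (v\<^sup>2 - 2 * \<rho> * v * q z + z * q z + \<alpha>)" (is "?E = ?F")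
    using nz by (simp add: field_simps power2_eq_square)
  \<comment> \<open>After this substitution \<rho>\<open>^3 = 1\<close> removes the quadratic terms
    in \<open>q\<close> from the derivative of \<open>w\<close> and leaves
    \<open>-2 * \<rho>\<^sup>2 * q * w\<close> as its part linear in \<open>q\<close>. Relative to
    \<open>w\<close> this is opposite to the term \<open>2 * \<rho>\<^sup>2 * q\<close> of
    \<open>2 * q' / q\<close>.\<close>
  moreover have "p z = v - \<rho> * q z" using v by simp
  then have "?D = ?F"
    using \<rho> unfolding w by algebra
  ultimately show ?thesis by simp
qed

section \<open>Limit at the endpoint of the path\<close>

theorem lemma2:
  fixes \<alpha> \<beta> \<rho> c zstar :: complex
    and \<gamma> :: "real \<Rightarrow> complex"
    and S :: "complex set"
    and q p :: "complex \<Rightarrow> complex"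
    and Q P :: "real \<Rightarrow> complex \<Rightarrow> complex"
  assumes "\<rho> \<in> {1, omega, cnj omega}"
    and "rectifiable_path \<gamma>"
    and "pathfinish \<gamma> = zstar"
    and "open S"
    and "pathstart \<gamma> \<in> S"
    and "solves_system \<alpha> \<beta> S q p"
    and "analytic_continuation_upto_end q \<gamma> Q"
    and "analytic_continuation_upto_end p \<gamma> P"
    and "tends_to_exceptional_point \<rho> c (\<lambda>t. Q t (\<gamma> t)) (\<lambda>t. P t (\<gamma> t))"
  shows "c = cnj \<rho> * zstar"
proof (rule ccontr)
  assume "c \<noteq> cnj \<rho> * zstar"
  note \<rho> = cube_root_of_unity[OF assms(1)]
  have path: "path \<gamma>" using assms(2) by (simp add: rectifiable_path_def)
  define qt where "qt t = Q t (\<gamma> t)" for t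
  define v where "v t = P t (\<gamma> t) + \<rho> * qt t" for t
  define w where "w t = v t - \<rho>\<^sup>2 * \<gamma> t" for t
  define h where "h t = w t * (qt t)\<^sup>2" for t
  have qnz: "\<forall>\<^sub>F t in at_left 1. qt t \<noteq> 0"
    and u: "((\<lambda>t. 1 / qt t) \<longlongrightarrow> 0) (at_left 1)"
    and v0: "((\<lambda>t. (P t (\<gamma> t) / qt t + \<rho>) / (1 / qt t)) \<longlongrightarrow> c) (at_left 1)"
    using assms(9) tendsto_fst[of _ "(0, c)"] tendsto_snd[of _ "(0, c)"]
    unfolding tends_to_exceptional_point_def blowup_chart2_def u1_def u2_def qt_def by fastforce+
  \<comment> \<open>The second coordinate of the second chart is \<open>p + \<rho> * q\<close>
    itself. This needs \<open>q\<close> to be non-zero: at \<open>q = 0\<close> the quotient would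
    be 0 by convention.\<close>
  have "\<forall>\<^sub>F t in at_left 1. (P t (\<gamma> t) / qt t + \<rho>) / (1 / qt t) = v t"
    using qnz by eventually_elim (simp add: v_def field_simps)
  with v0 have v: "(v \<longlongrightarrow> c) (at_left 1)" by (simp add: tendsto_cong)
  have z: "(\<gamma> \<longlongrightarrow> zstar) (at_left 1)"
  proof -
    have "(\<gamma> \<longlongrightarrow> \<gamma> 1) (at 1 within {0..1})"
      using path by (simp add: path_def continuous_on_def)
    then show ?thesis
      using assms(3) by (simp add: pathfinish_def at_within_Icc_at_left)
  qed
  define w0 where "w0 = c - \<rho>\<^sup>2 * zstar"
  have w0: "w0 \<noteq> 0" using \<open>c \<noteq> cnj \<rho> * zstar\<close> \<rho>(2) by (simp add: w0_def)
  have w: "(w \<longlongrightarrow> w0) (at_left 1)"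
    unfolding w_def w0_def by (intro tendsto_intros v z)
  \<comment> \<open>\<open>G\<close> is the logarithmic derivative of \<open>h\<close> along the
    path. With the terms in \<open>q\<close> cancelled, it involves only \<gamma>, \<open>v\<close>,
    \<open>w\<close> and \<open>1 / qt\<close>, which all converge; the assumed non-zero limit of
    \<open>w\<close> makes the quotient converge too.\<close>
  define G where "G t = (\<rho> * (v t)\<^sup>2 - \<gamma> t * v t + \<rho> * \<alpha> - \<beta> - \<rho>\<^sup>2) / w t
       + 2 * ((v t)\<^sup>2 * (1 / qt t) - 2 * \<rho> * v t + \<gamma> t + \<alpha> * (1 / qt t))" for t
  define G0 where "G0 = (\<rho> * c\<^sup>2 - zstar * c + \<rho> * \<alpha> - \<beta> - \<rho>\<^sup>2) / w0
       + 2 * (c\<^sup>2 * 0 - 2 * \<rho> * c + zstar + \<alpha> * 0)"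
  have "(G \<longlongrightarrow> G0) (at_left 1)"
    unfolding G_def G0_def by (intro tendsto_intros v z w u w0)
  then have "((\<lambda>t. norm (G t)) \<longlongrightarrow> norm G0) (at_left 1)" by (rule tendsto_norm)
  then have Gev: "\<forall>\<^sub>F t in at_left 1. norm (G t) < norm G0 + 1"
    by (rule order_tendstoD) simp
  define K where "K = norm G0 + 1"
  have "\<forall>\<^sub>F t in at_left (1::real). t > 0"
    by (simp add: eventually_at_left_real eventually_at_left_field exI[of _ 0])
  with qnz Gev tendsto_imp_eventually_ne[OF w w0]
  have "\<forall>\<^sub>F t in at_left 1. qt t \<noteq> 0 \<and> w t \<noteq> 0 \<and> norm (G t) < K \<and> t > 0"
    unfolding K_def by eventually_elim auto
  then obtain b where "b < 1" and b: "\<And>t. b < t \<Longrightarrow> t < 1 \<Longrightarrow> qt t \<noteq> 0 \<and> w t \<noteq> 0 \<and> norm (G t) < K \<and> t > 0"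
    unfolding eventually_at_left_field by blast
  \<comment> \<open>Starting strictly to the right of \<open>b\<close> makes the bounds available on
    every closed interval \<open>{a..t}\<close> with \<open>t < 1\<close>.\<close>
  define a where "a = (b + 1) / 2"
  have a: "b < a" "a < 1" "0 < a"
    using \<open>b < 1\<close> b[of a] by (auto simp: a_def)
  obtain V where V: "\<And>a b. 0 \<le> a \<Longrightarrow> a \<le> b \<Longrightarrow> b \<le> 1 \<Longrightarrow> dist (\<gamma> a) (\<gamma> b) \<le> V b - V a"
    using rectifiable_path_length_function[OF assms(2)] by blast
  have bound: "norm (h t) \<le> norm (h a) * exp (K * (V 1 - V a))" if t: "a \<le> t" "t < 1" for t
  proof -
    have "norm (h t) \<le> norm (h a) * exp (K * (V t - V a))"
    proof (rule norm_growth_along_path[OF t(1)])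
      show "continuous_on {a..t} \<gamma>"
        by (rule continuous_on_subset[OF path[unfolded path_def]]) (use t a in auto)
      show "dist (\<gamma> x) (\<gamma> y) \<le> V y - V x" if "a \<le> x" "x \<le> y" "y \<le> t" for x y
        using V that t a by auto
      show "K \<ge> 0" by (simp add: K_def)
    next
      fix x assume x: "x \<in> {a..t}"
      then have x01: "x \<in> {0..<1}" using a t by auto
      have bx: "qt x \<noteq> 0" "w x \<noteq> 0" "norm (G x) < K" using b[of x] x a t by auto
      obtain N where N: "\<gamma> x \<in> N" "solves_system \<alpha> \<beta> N (Q x) (P x)"
        using solves_system_continuation[OF path assms(4-8) x01] by blast
      \<comment> \<open>\<open>h\<close> depends on the path parameter, while \<open>f\<close> is a
        function of the complex variable built from the fixed function elements at
        \<open>x\<close>.\<close>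
      define f where "f z = (P x z + \<rho> * Q x z - \<rho>\<^sup>2 * z) * (Q x z)\<^sup>2" for z
      have "(f has_field_derivative h x * G x) (at (\<gamma> x))"
        unfolding f_def h_def G_def qt_def
        by (rule log_derivative_cancellation[OF \<rho>(1)])
          (use N bx in \<open>auto simp: solves_system_def qt_def w_def v_def\<close>)
      moreover have "norm (h x * G x) < K * norm (h x)"
        using bx by (simp add: norm_mult h_def)
      moreover have "f (\<gamma> x) = h x"
        by (simp add: f_def h_def w_def v_def qt_def)
      moreover have "\<forall>\<^sub>F s in at x within {a..t}. h s = f (\<gamma> s)"
      \<comment> \<open>The function elements at \<open>s\<close> and \<open>x\<close> agree near
        \<gamma> \<open>s\<close>; evaluating at \<gamma> \<open>s\<close> identifies
        \<open>h s\<close> with \<open>f\<close> there.\<close>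
      proof -
        have "\<forall>\<^sub>F s in at x within {0..<1}. \<forall>\<^sub>F z in nhds (\<gamma> s). Q s z = Q x z"
          using assms(7) x01 unfolding analytic_continuation_upto_end_def
          by (fastforce elim: eventually_mono)
        moreover have "\<forall>\<^sub>F s in at x within {0..<1}. \<forall>\<^sub>F z in nhds (\<gamma> s). P s z = P x z"
          using assms(8) x01 unfolding analytic_continuation_upto_end_def
          by (fastforce elim: eventually_mono)
        ultimately have "\<forall>\<^sub>F s in at x within {0..<1}. h s = f (\<gamma> s)"
          by eventually_elim
            (auto dest!: eventually_nhds_x_imp_x simp: f_def h_def w_def v_def qt_def)
        moreover have "at x within {a..t} \<le> at x within {0..<1}"
          using a t by (intro at_le) auto
        ultimately show ?thesis by (rule filter_leD[rotated])
      qed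
      ultimately show "\<exists>f D. (f has_field_derivative D) (at (\<gamma> x)) \<and> norm D < K * norm (h x) \<and>
          f (\<gamma> x) = h x \<and> (\<forall>\<^sub>F s in at x within {a..t}. h s = f (\<gamma> s))"
        by blast
    qed
    \<comment> \<open>Here the finite length up to the endpoint enters: the bound on
      \<open>h\<close> becomes independent of \<open>t\<close>.\<close>
    also have "V t \<le> V 1"
      using V[of t 1] a t zero_le_dist[of "\<gamma> t" "\<gamma> 1"] by linarith
    then have "norm (h a) * exp (K * (V t - V a)) \<le> norm (h a) * exp (K * (V 1 - V a))"
      by (intro mult_left_mono) (auto simp: K_def intro!: mult_left_mono)
    finally show ?thesis .
  qed
  define M where "M = norm (h a) * exp (K * (V 1 - V a))"
  \<comment> \<open>Since \<open>w = h * (1 / qt)\<^sup>2\<close> with \<open>h\<close> bounded and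
    \<open>1 / qt\<close> tending to 0, \<open>w\<close> must tend to 0, against its non-zero limit
    \<open>w0\<close>.\<close>
  have "\<forall>\<^sub>F t in at_left 1. norm (w t) \<le> M * (norm (1 / qt t))\<^sup>2"
    unfolding eventually_at_left_field
  proof (intro exI[of _ a] conjI allI impI)
    fix t assume t: "t > a" "t < 1"
    have "qt t \<noteq> 0" using b[of t] t a by simp
    then have "norm (w t) = norm (h t) * (norm (1 / qt t))\<^sup>2"
      by (simp add: h_def norm_mult norm_divide norm_power field_simps)
    also have "\<dots> \<le> M * (norm (1 / qt t))\<^sup>2"
      using bound[of t] t unfolding M_def by (intro mult_right_mono) auto
    finally show "norm (w t) \<le> M * (norm (1 / qt t))\<^sup>2" .
  qed (use a in auto)
  moreover have "((\<lambda>t. M * (norm (1 / qt t))\<^sup>2) \<longlongrightarrow> M * (norm (0::complex))\<^sup>2) (at_left 1)"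
    by (intro tendsto_intros u)
  then have "((\<lambda>t. M * (norm (1 / qt t))\<^sup>2) \<longlongrightarrow> 0) (at_left 1)" by simp
  ultimately have "(w \<longlongrightarrow> 0) (at_left 1)"
    by (rule Lim_null_comparison)
  with w have "w0 = 0"
    by (rule tendsto_unique[rotated]) simp
  with w0 show False by simp
qed

end
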